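(* Let $\Sigma\in S_{2d}^{++}(\mathbb{R})$ and $\varepsilon>0$. Write $\Sigma=\begin{pmatrix}A_{\mathrm{ref}}&C_{\mathrm{ref}}\\C_{\mathrm{ref}}^T&B_{\mathrm{ref}}\end{pmatrix}$ with $d\times d$ blocks, and let $R_{\mathrm{ref}}\in M_d(\mathbb{R})$ be the matrix such that $C_{\mathrm{ref}}=A_{\mathrm{ref}}^{1/2}R_{\mathrm{ref}}B_{\mathrm{ref}}^{1/2}$. Let $\Gamma_{12}$ be the upper-right $d\times d$ block of $\Sigma^{-1}$. If $$\varepsilon\left(\frac{\|R_{\mathrm{ref}}\|_{\mathrm{op}}}{1-\|R_{\mathrm{ref}}\|_{\mathrm{op}}^2}\right)<\frac{1}{\|A_{\mathrm{ref}}^{-1/2}\|_{\mathrm{op}}\|B_{\mathrm{ref}}^{-1/2}\|_{\mathrm{op}}},$$ then the matrix $M_\varepsilon=I_d-\varepsilon\Gamma_{12}$ is invertible. Equivalently formulated, denoting by $\sigma_1[r]$ the largest singular value of $R_{\mathrm{ref}}$ and by $\lambda_d[a]$ and $\lambda_d[b]$ the smallest eigenvalues of $A_{\mathrm{ref}}$ and $B_{\mathrm{ref}}$, the inequality $$\varepsilon\left(\frac{\sigma_1[r]}{1-\sigma_1[r]^2}\right)<\sqrt{\lambda_d[a]\lambda_d[b]}$$ ensures the invertibility of $M_\varepsilon$.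
   Context: $M_d(\mathbb{R})$ is the space of real $d\times d$ matrices and $S_{2d}^{++}(\mathbb{R})$ the set of real symmetric positive-definite $2d\times 2d$ matrices. $\|R\|_{\mathrm{op}}:=\sup_{\|x\|\le1}\|Rx\|$. Square roots of positive-definite matrices are the usual positive-definite ones. Since $\Sigma$ is positive-definite, $A_{\mathrm{ref}}$ and $B_{\mathrm{ref}}$ are positive-definite and $\|R_{\mathrm{ref}}\|_{\mathrm{op}}<1$. *)

theory Defs
  imports "HOL-Analysis.Analysis"
begin

definition pos_def :: "real^'n^'n \<Rightarrow> bool" where
  "pos_def A \<longleftrightarrow> transpose A = A \<and> (\<forall>x. x \<noteq> 0 \<longrightarrow> x \<bullet> (A *v x) > 0)"

text \<open>A positive-definite matrix has exactly one positive-definite square root; the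
  description below is meaningful only for positive-definite arguments.\<close>

definition mat_sqrt :: "real^'n^'n \<Rightarrow> real^'n^'n" where
  "mat_sqrt A = (THE S. pos_def S \<and> S ** S = A)"

text \<open>Library operator norm; on Euclidean spaces it equals the supremum of
  \<open>norm (A *v x)\<close> over the closed unit ball.\<close>

abbreviation op_norm :: "real^'n^'m \<Rightarrow> real" where
  "op_norm A \<equiv> onorm (\<lambda>x. A *v x)"

text \<open>Indexing by the sum type makes \<open>real^('n + 'n)^('n + 'n)\<close> the space of
  \<open>2d \<times> 2d\<close> matrices for \<open>d = CARD('n)\<close>; \<open>Inl\<close> and \<open>Inr\<close> address
  the first and the last \<open>d\<close> coordinates.\<close>

definition block_mat ::
    "real^'n^'n \<Rightarrow> real^'n^'n \<Rightarrow> real^'n^'n \<Rightarrow> real^'n^'n \<Rightarrow> real^('n + 'n)^('n + 'n)" where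
  "block_mat P Q S T = (\<chi> i j. case i of
      Inl k \<Rightarrow> (case j of Inl l \<Rightarrow> P $ k $ l | Inr l \<Rightarrow> Q $ k $ l)
    | Inr k \<Rightarrow> (case j of Inl l \<Rightarrow> S $ k $ l | Inr l \<Rightarrow> T $ k $ l))"

definition upper_right :: "real^('n + 'n)^('n + 'n) \<Rightarrow> real^'n^'n" where
  "upper_right M = (\<chi> k l. M $ Inl k $ Inr l)"

definition eigenvalues :: "real^'n^'n \<Rightarrow> real set" where
  "eigenvalues A = {\<mu>. \<exists>v. v \<noteq> 0 \<and> A *v v = \<mu> *\<^sub>R v}"

definition singular_values :: "real^'n^'n \<Rightarrow> real set" where
  "singular_values A = sqrt ` eigenvalues (transpose A ** A)"

text \<open>For symmetric \<open>A\<close> the set \<open>eigenvalues A\<close> is finite and nonempty, so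
  \<open>Min\<close> is well defined there; likewise \<open>Max\<close> for the singular values of any \<open>A\<close>.\<close>

definition min_eigenvalue :: "real^'n^'n \<Rightarrow> real" where
  "min_eigenvalue A = Min (eigenvalues A)"

definition max_singular_value :: "real^'n^'n \<Rightarrow> real" where
  "max_singular_value A = Max (singular_values A)"

end

theory Submission
  imports Defs
begin

text \<open>
  The matrix \<open>I - \<epsilon> \<Gamma>\<close> is invertible as soon as \<open>\<epsilon> \<parallel>\<Gamma>\<parallel> < 1\<close>, so everything rests on the bound
  \<open>\<parallel>\<Gamma>\<parallel> \<le> \<parallel>A\<^sup>-\<^sup>1\<^sup>/\<^sup>2\<parallel> \<parallel>B\<^sup>-\<^sup>1\<^sup>/\<^sup>2\<parallel> r / (1 - r\<^sup>2)\<close> for the upper right block \<open>\<Gamma>\<close> of \<open>\<Sigma>\<^sup>-\<^sup>1\<close>, where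
  \<open>r = \<parallel>R\<parallel>\<close> (\<open>upper_right_inverse_bound\<close>). It is obtained without a formula for \<open>\<Gamma>\<close>: the vector
  \<open>\<Gamma> y\<close> is the first half \<open>p\<close> of the solution of \<open>\<Sigma> (p, q) = (0, y)\<close>. In the coordinates
  \<open>u = A\<^sup>1\<^sup>/\<^sup>2 p\<close> and \<open>w = B\<^sup>1\<^sup>/\<^sup>2 q\<close> the first row of this system becomes \<open>u = - R w\<close>, and the inner
  product of the second row with \<open>q\<close> becomes \<open>\<parallel>w\<parallel>\<^sup>2 - \<parallel>u\<parallel>\<^sup>2 = q \<bullet> y\<close>. Hence
  \<open>(1 - r\<^sup>2) \<parallel>w\<parallel> \<le> \<parallel>B\<^sup>-\<^sup>1\<^sup>/\<^sup>2\<parallel> \<parallel>y\<parallel>\<close> and \<open>\<parallel>u\<parallel> \<le> r \<parallel>w\<parallel>\<close>. The division by \<open>1 - r\<^sup>2\<close> is allowed since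
  the quadratic form of \<open>\<Sigma>\<close>, tested on \<open>u = - R w\<close>, equals \<open>\<parallel>w\<parallel>\<^sup>2 - \<parallel>R w\<parallel>\<^sup>2\<close>
  (\<open>correlation_op_norm_less_1\<close>).

  The two forms of the hypothesis agree side by side: \<open>\<parallel>R\<parallel>\<close> is the largest singular value of \<open>R\<close>
  (\<open>op_norm_max_singular_value\<close>), and \<open>\<parallel>A\<^sup>-\<^sup>1\<^sup>/\<^sup>2\<parallel> = 1 / sqrt \<lambda>\<close> for the smallest eigenvalue \<open>\<lambda>\<close> of \<open>A\<close>
  (\<open>op_norm_inv_mat_sqrt\<close>).

  Both identities, and the existence and uniqueness of the square root, need the spectral theorem
  for real symmetric matrices, which is proved here by maximising the Rayleigh quotient.
\<close>

section \<open>The spectral theorem for symmetric operators\<close>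

text \<open>A maximiser \<open>v\<close> of \<open>x \<bullet> f x\<close> on the unit sphere of \<open>V\<close> is an eigenvector, since the first variation
  of \<open>x \<bullet> f x - l (x \<bullet> x)\<close> vanishes at \<open>v\<close>. The invariant subspace \<open>V\<close> is a parameter so that the
  construction can be repeated on the orthogonal complement of \<open>v\<close>.\<close>
lemma symmetric_max_eigenvector:
  fixes f :: "'a::euclidean_space \<Rightarrow> 'a"
  assumes lin: "linear f" and sym: "\<And>x y. x \<bullet> f y = f x \<bullet> y"
    and V: "subspace V" "V \<noteq> {0}" and inv: "\<And>x. x \<in> V \<Longrightarrow> f x \<in> V"
  obtains v where "v \<in> V" "norm v = 1" "f v = (v \<bullet> f v) *\<^sub>R v"
    "\<And>x. x \<in> V \<Longrightarrow> x \<bullet> f x \<le> (v \<bullet> f v) * (norm x)\<^sup>2"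
proof -
  have ne: "sphere 0 1 \<inter> V \<noteq> {}"
  proof -
    obtain w where w: "w \<in> V" "w \<noteq> 0"
      using V subspace_0 by auto
    have "w /\<^sub>R norm w \<in> sphere 0 1 \<inter> V"
      using w V by (simp add: subspace_mul)
    then show ?thesis by blast
  qed
  have cpt: "compact (sphere 0 1 \<inter> V)"
    using V by (intro compact_Int_closed closed_subspace) simp_all
  have cont: "continuous_on (sphere 0 1 \<inter> V) (\<lambda>x. x \<bullet> f x)"
    using lin by (intro continuous_intros linear_continuous_on linear_conv_bounded_linear[THEN iffD1])
  obtain v where v: "v \<in> V" "norm v = 1"
    and max: "\<And>y. y \<in> V \<Longrightarrow> norm y = 1 \<Longrightarrow> y \<bullet> f y \<le> v \<bullet> f v"
    using continuous_attains_sup[OF cpt ne cont] by auto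
  define l where "l = v \<bullet> f v"
  have le: "x \<bullet> f x \<le> l * (norm x)\<^sup>2" if "x \<in> V" for x
  proof (cases "x = 0")
    case True
    then show ?thesis by (simp add: linear_0[OF lin])
  next
    case False
    have "(x /\<^sub>R norm x) \<bullet> f (x /\<^sub>R norm x) \<le> l"
      unfolding l_def using False that V by (intro max) (simp_all add: subspace_mul)
    then have "x \<bullet> f x / (norm x)\<^sup>2 \<le> l"
      by (simp add: linear_cmul[OF lin] divide_inverse power2_eq_square ac_simps)
    then show ?thesis using False by (simp add: divide_le_eq)
  qed
  define w where "w = f v - l *\<^sub>R v"
  have wV: "w \<in> V"
    unfolding w_def using V v inv by (simp add: subspace_diff subspace_mul)
  define K where "K = l * (norm w)\<^sup>2 - w \<bullet> f w"
  have K: "K \<ge> 0" using le[OF wV] by (simp add: K_def)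
  have vv: "v \<bullet> v = 1" using v(2) by (simp add: norm_eq_1)
  \<comment> \<open>Maximality along the direction \<open>w\<close>: the residual \<open>w\<close> gives a linear term in \<open>t\<close> with coefficient
    \<open>2 (norm w)\<^sup>2\<close>, which for small \<open>t > 0\<close> exceeds any quadratic term unless \<open>w = 0\<close>.\<close>
  have quad: "2 * t * (norm w)\<^sup>2 \<le> t\<^sup>2 * K" for t
  proof -
    have "v + t *\<^sub>R w \<in> V" using V v wV by (simp add: subspace_add subspace_mul)
    from le[OF this] have "(v + t *\<^sub>R w) \<bullet> f (v + t *\<^sub>R w) \<le> l * ((v + t *\<^sub>R w) \<bullet> (v + t *\<^sub>R w))"
      by (simp add: power2_norm_eq_inner)
    then have "l + 2 * t * (w \<bullet> f v) + t\<^sup>2 * (w \<bullet> f w) \<le> l * (1 + 2 * t * (w \<bullet> v) + t\<^sup>2 * (w \<bullet> w))"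
      using sym[of v w] vv
      by (simp add: linear_add[OF lin] linear_cmul[OF lin] inner_add_left inner_add_right
          inner_commute l_def power2_eq_square algebra_simps)
    moreover have "w \<bullet> f v = w \<bullet> w + l * (w \<bullet> v)"
    proof -
      have "f v = w + l *\<^sub>R v" by (simp add: w_def)
      then show ?thesis by (simp only: inner_add_right inner_scaleR_right)
    qed
    ultimately show ?thesis
      by (simp add: K_def power2_norm_eq_inner algebra_simps)
  qed
  have "w = 0"
  proof (rule ccontr)
    assume "w \<noteq> 0"
    define n where "n = (norm w)\<^sup>2"
    have n: "n > 0" using \<open>w \<noteq> 0\<close> by (simp add: n_def)
    define t where "t = n / (K + 1)"
    have t: "t > 0" using n K by (simp add: t_def)
    have "t * (2 * n) \<le> t * (t * K)"
      using quad[of t] by (simp add: n_def power2_eq_square ac_simps)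
    then have "2 * n \<le> t * K" using t by simp
    also have "\<dots> \<le> t * (K + 1)" using t by simp
    also have "\<dots> = n" using K by (simp add: t_def)
    finally show False using n by simp
  qed
  then have "f v = (v \<bullet> f v) *\<^sub>R v" by (simp add: w_def l_def)
  with v le show ?thesis by (intro that[of v]) (auto simp: l_def)
qed

text \<open>The eigenvalue of a unit eigenvector \<open>b\<close> is written \<open>b \<bullet> f b\<close>, which saves a separate eigenvalue
  function. Spanning is encoded as the Fourier expansion, the only form in which it is needed.\<close>
definition orthonormal_eigenbasis :: "('a::euclidean_space \<Rightarrow> 'a) \<Rightarrow> 'a set \<Rightarrow> 'a set \<Rightarrow> bool" where
  "orthonormal_eigenbasis f V E \<longleftrightarrow> finite E \<and> E \<subseteq> V
    \<and> (\<forall>b\<in>E. norm b = 1) \<and> (\<forall>b\<in>E. f b = (b \<bullet> f b) *\<^sub>R b)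
    \<and> (\<forall>b\<in>E. \<forall>c\<in>E. b \<noteq> c \<longrightarrow> b \<bullet> c = 0)
    \<and> (\<forall>x\<in>V. (\<Sum>b\<in>E. (x \<bullet> b) *\<^sub>R b) = x)"

lemma orthonormal_eigenbasisD:
  assumes "orthonormal_eigenbasis f V E"
  shows "finite E" "E \<subseteq> V" "\<And>b. b \<in> E \<Longrightarrow> norm b = 1"
    "\<And>b. b \<in> E \<Longrightarrow> f b = (b \<bullet> f b) *\<^sub>R b"
    "\<And>b c. b \<in> E \<Longrightarrow> c \<in> E \<Longrightarrow> b \<noteq> c \<Longrightarrow> b \<bullet> c = 0"
    "\<And>x. x \<in> V \<Longrightarrow> (\<Sum>b\<in>E. (x \<bullet> b) *\<^sub>R b) = x"
  using assms unfolding orthonormal_eigenbasis_def by blast+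

lemma orthonormal_eigenbasis_nonzero_coordinate:
  assumes "orthonormal_eigenbasis f V E" "x \<in> V" "x \<noteq> 0"
  obtains b where "b \<in> E" "x \<bullet> b \<noteq> 0"
proof (rule ccontr)
  assume "\<not> thesis"
  then have "\<forall>b\<in>E. x \<bullet> b = 0" using that by blast
  then have "(\<Sum>b\<in>E. (x \<bullet> b) *\<^sub>R b) = 0" by simp
  then show False using orthonormal_eigenbasisD(6)[OF assms(1,2)] assms(3) by simp
qed

text \<open>Induction on the dimension: the orthogonal complement of an eigenvector inside \<open>V\<close> is again
  invariant, because \<open>v \<bullet> f x = f v \<bullet> x\<close> is a multiple of \<open>v \<bullet> x\<close>.\<close>
lemma symmetric_eigenbasis_on:
  fixes f :: "'a::euclidean_space \<Rightarrow> 'a"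
  assumes lin: "linear f" and sym: "\<And>x y. x \<bullet> f y = f x \<bullet> y"
    and "subspace V" and "\<And>x. x \<in> V \<Longrightarrow> f x \<in> V"
  shows "\<exists>E. orthonormal_eigenbasis f V E"
  using assms(3,4)
proof (induction "dim V" arbitrary: V rule: less_induct)
  case less
  show ?case
  proof (cases "V = {0}")
    case True
    then show ?thesis by (intro exI[of _ "{}"]) (simp add: orthonormal_eigenbasis_def)
  next
    case False
    obtain v where v: "v \<in> V" "norm v = 1" "f v = (v \<bullet> f v) *\<^sub>R v"
      using symmetric_max_eigenvector[OF lin sym less.prems(1) False less.prems(2)] by metis
    have vv: "v \<bullet> v = 1" using v(2) by (simp add: norm_eq_1)
    define W where "W = V \<inter> {x. v \<bullet> x = 0}"
    have W: "subspace W"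
      unfolding W_def by (intro subspace_inter less.prems subspace_hyperplane)
    have "v \<notin> W" using vv by (simp add: W_def)
    then have "W \<subset> V" using v(1) unfolding W_def by blast
    then have dim: "dim W < dim V"
      using W less.prems(1) by (intro dim_psubset) (simp add: span_eq_iff[THEN iffD2])
    have invW: "f x \<in> W" if "x \<in> W" for x
    proof -
      have "v \<bullet> f x = (v \<bullet> f v) * (v \<bullet> x)"
        by (metis sym v(3) inner_scaleR_left)
      with that less.prems(2) show ?thesis by (simp add: W_def)
    qed
    from less.hyps[OF dim W invW] obtain E where "orthonormal_eigenbasis f W E" ..
    note E = orthonormal_eigenbasisD[OF this]
    have vE: "v \<notin> E" using E(2) \<open>v \<notin> W\<close> by blast
    have orth: "v \<bullet> b = 0" "b \<bullet> v = 0" if "b \<in> E" for b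
      using that E(2) by (auto simp: W_def inner_commute)
    have exp: "(\<Sum>b\<in>insert v E. (x \<bullet> b) *\<^sub>R b) = x" if "x \<in> V" for x
    proof -
      have "x - (x \<bullet> v) *\<^sub>R v \<in> W"
        using that v(1) less.prems(1) vv
        by (simp add: W_def subspace_diff subspace_mul inner_diff_right inner_commute)
      from E(6)[OF this] have "(\<Sum>b\<in>E. (x \<bullet> b) *\<^sub>R b) = x - (x \<bullet> v) *\<^sub>R v"
        by (simp add: inner_diff_left orth cong: sum.cong)
      then show ?thesis using E(1) vE by (simp add: algebra_simps)
    qed
    show ?thesis
      unfolding orthonormal_eigenbasis_def
    proof (intro exI[of _ "insert v E"] conjI ballI)
      show "finite (insert v E)" "insert v E \<subseteq> V"
        using E(1,2) v(1) by (auto simp: W_def)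
      show "norm b = 1" if "b \<in> insert v E" for b using that E(3) v(2) by blast
      show "f b = (b \<bullet> f b) *\<^sub>R b" if "b \<in> insert v E" for b
        using that v(3) E(4)[of b] by (metis insertE)
      show "b \<noteq> c \<longrightarrow> b \<bullet> c = 0" if "b \<in> insert v E" "c \<in> insert v E" for b c
        using that E(5)[of b c] orth by auto
      show "(\<Sum>b\<in>insert v E. (x \<bullet> b) *\<^sub>R b) = x" if "x \<in> V" for x
        using exp[OF that] .
    qed
  qed
qed

lemma symmetric_matrix_iff:
  fixes A :: "real^'n^'n"
  shows "transpose A = A \<longleftrightarrow> (\<forall>x y. x \<bullet> (A *v y) = (A *v x) \<bullet> y)"
proof
  assume "transpose A = A"
  then have "x v* A = A *v x" for x by (metis transpose_matrix_vector)
  then show "\<forall>x y. x \<bullet> (A *v y) = (A *v x) \<bullet> y" by (metis dot_lmul_matrix)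
next
  assume *: "\<forall>x y. x \<bullet> (A *v y) = (A *v x) \<bullet> y"
  have "x v* A = A *v x" for x
    using * by (metis dot_lmul_matrix vector_eq_rdot)
  then show "transpose A = A" by (simp add: matrix_eq)
qed

lemma symmetric_matrix_eigenbasis:
  fixes A :: "real^'n^'n"
  assumes "transpose A = A"
  obtains E where "orthonormal_eigenbasis ((*v) A) UNIV E"
proof -
  have sym: "\<And>x y. x \<bullet> (A *v y) = (A *v x) \<bullet> y"
    using assms symmetric_matrix_iff by metis
  from symmetric_eigenbasis_on[OF matrix_vector_mul_linear sym subspace_UNIV UNIV_I]
  show ?thesis using that by blast
qed

section \<open>Extreme eigenvalues\<close>

text \<open>Comparing coordinates with respect to an eigenbasis, every eigenvalue belongs to some basis vector.\<close>
lemma finite_eigenvalues_symmetric: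
  fixes A :: "real^'n^'n"
  assumes "transpose A = A"
  shows "finite (eigenvalues A)"
proof -
  obtain E where eb: "orthonormal_eigenbasis ((*v) A) UNIV E"
    by (rule symmetric_matrix_eigenbasis[OF assms])
  note E = orthonormal_eigenbasisD[OF this]
  have "eigenvalues A \<subseteq> (\<lambda>b. b \<bullet> (A *v b)) ` E"
  proof
    fix \<mu> assume "\<mu> \<in> eigenvalues A"
    then obtain v where v: "v \<noteq> 0" "A *v v = \<mu> *\<^sub>R v" by (auto simp: eigenvalues_def)
    obtain b where b: "b \<in> E" "v \<bullet> b \<noteq> 0"
      by (rule orthonormal_eigenbasis_nonzero_coordinate[OF eb UNIV_I v(1)])
    have "\<mu> * (v \<bullet> b) = (A *v v) \<bullet> b" by (simp add: v)
    also have "\<dots> = v \<bullet> (A *v b)" using assms symmetric_matrix_iff by metis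
    also have "\<dots> = (b \<bullet> (A *v b)) * (v \<bullet> b)" by (subst E(4)[OF b(1)]) simp
    finally show "\<mu> \<in> (\<lambda>b. b \<bullet> (A *v b)) ` E" using b by simp
  qed
  then show ?thesis using E(1) finite_surj by blast
qed

text \<open>The maximum of the Rayleigh quotient is an eigenvalue and bounds every other one, so the
  variational maximum is the \<open>Max\<close> of the set of eigenvalues.\<close>
lemma symmetric_Max_eigenvalue:
  fixes A :: "real^'n^'n"
  assumes "transpose A = A"
  obtains v where "norm v = 1" "A *v v = Max (eigenvalues A) *\<^sub>R v"
    "\<And>x. x \<bullet> (A *v x) \<le> Max (eigenvalues A) * (norm x)\<^sup>2"
proof -
  have sym: "\<And>x y. x \<bullet> (A *v y) = (A *v x) \<bullet> y"
    using assms symmetric_matrix_iff by metis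
  have "(UNIV :: (real^'n) set) \<noteq> {0}"
    by (metis UNIV_I singletonD zero_neq_one)
  then obtain v where v: "norm v = 1" "A *v v = (v \<bullet> (A *v v)) *\<^sub>R v"
    "\<And>x. x \<bullet> (A *v x) \<le> (v \<bullet> (A *v v)) * (norm x)\<^sup>2"
    by (rule symmetric_max_eigenvector[OF matrix_vector_mul_linear sym subspace_UNIV]) simp_all
  have "Max (eigenvalues A) = v \<bullet> (A *v v)"
  proof (rule Max_eqI[OF finite_eigenvalues_symmetric[OF assms]])
    show "v \<bullet> (A *v v) \<in> eigenvalues A"
      unfolding eigenvalues_def using v(1,2) norm_zero zero_neq_one by (metis (mono_tags, lifting) mem_Collect_eq)
  next
    fix \<mu> assume "\<mu> \<in> eigenvalues A"
    then obtain x where x: "x \<noteq> 0" "A *v x = \<mu> *\<^sub>R x" by (auto simp: eigenvalues_def)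
    then have "\<mu> * (norm x)\<^sup>2 \<le> (v \<bullet> (A *v v)) * (norm x)\<^sup>2"
      using v(3)[of x] by (simp add: power2_norm_eq_inner)
    then show "\<mu> \<le> v \<bullet> (A *v v)" using x(1) by simp
  qed
  with v show ?thesis by (intro that[of v]) simp_all
qed

lemma eigenvalues_uminus: "eigenvalues (- A) = uminus ` eigenvalues A"
proof -
  have eq: "(- A) *v v = \<mu> *\<^sub>R v \<longleftrightarrow> A *v v = (- \<mu>) *\<^sub>R v" for v :: "real^'a" and \<mu>
    using matrix_vector_mult_diff_rdistrib[of 0 A v] by (auto simp: minus_equation_iff[of "A *v v"])
  show ?thesis
  proof (intro equalityI subsetI)
    fix \<mu> assume "\<mu> \<in> eigenvalues (- A)"
    then have "- \<mu> \<in> eigenvalues A" by (simp add: eigenvalues_def eq)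
    then show "\<mu> \<in> uminus ` eigenvalues A" by (metis image_eqI minus_minus)
  next
    fix \<mu> assume "\<mu> \<in> uminus ` eigenvalues A"
    then show "\<mu> \<in> eigenvalues (- A)" by (auto simp: eigenvalues_def eq)
  qed
qed

text \<open>This is the maximum principle for \<open>- A\<close>.\<close>
lemma symmetric_min_eigenvalue:
  fixes A :: "real^'n^'n"
  assumes "transpose A = A"
  obtains v where "norm v = 1" "A *v v = min_eigenvalue A *\<^sub>R v"
    "\<And>x. min_eigenvalue A * (norm x)\<^sup>2 \<le> x \<bullet> (A *v x)"
proof -
  have neg: "(- A) *v x = - (A *v x)" for x
    using matrix_vector_mult_diff_rdistrib[of 0 A x] by simp
  have "transpose (- A) = - A"
    using assms by (simp add: symmetric_matrix_iff neg)
  then obtain v where v: "norm v = 1" "(- A) *v v = Max (eigenvalues (- A)) *\<^sub>R v"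
    "\<And>x. x \<bullet> ((- A) *v x) \<le> Max (eigenvalues (- A)) * (norm x)\<^sup>2"
    using symmetric_Max_eigenvalue by blast
  have ne: "eigenvalues (- A) \<noteq> {}"
    using v(1,2) unfolding eigenvalues_def by (metis (mono_tags, lifting) empty_iff mem_Collect_eq norm_zero zero_neq_one)
  have "- Max (eigenvalues (- A)) = Min (uminus ` eigenvalues (- A))"
    using finite_eigenvalues_symmetric[OF \<open>transpose (- A) = - A\<close>] ne by (rule minus_Max_eq_Min)
  then have "Max (eigenvalues (- A)) = - min_eigenvalue A"
    by (simp add: min_eigenvalue_def eigenvalues_uminus image_image)
  note v = v[unfolded this neg inner_minus_right]
  show ?thesis
  proof (rule that[OF v(1)])
    show "A *v v = min_eigenvalue A *\<^sub>R v" using v(2) by simp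
    show "min_eigenvalue A * (norm x)\<^sup>2 \<le> x \<bullet> (A *v x)" for x using v(3)[of x] by simp
  qed
qed

section \<open>The positive-definite square root\<close>

text \<open>The root acts on an orthonormal eigenbasis of \<open>A\<close> by the square roots of the eigenvalues.\<close>
lemma pos_def_sqrt_exists:
  fixes A :: "real^'n^'n"
  assumes "pos_def A"
  shows "\<exists>S. pos_def S \<and> S ** S = A"
proof -
  have "transpose A = A" using assms by (simp add: pos_def_def)
  then obtain E where eb: "orthonormal_eigenbasis ((*v) A) UNIV E"
    by (rule symmetric_matrix_eigenbasis)
  note E = orthonormal_eigenbasisD[OF this]
  define \<sigma> where "\<sigma> b = sqrt (b \<bullet> (A *v b))" for b
  have pos: "b \<bullet> (A *v b) > 0" if "b \<in> E" for b
    using E(3)[OF that] assms unfolding pos_def_def by (metis norm_zero zero_neq_one)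
  define g where "g x = (\<Sum>b\<in>E. (\<sigma> b * (x \<bullet> b)) *\<^sub>R b)" for x
  have lin: "linear g"
    unfolding g_def by (rule linearI)
      (simp_all add: inner_add_left scaleR_add_left distrib_left sum.distrib scaleR_sum_right ac_simps)
  define S where "S = matrix g"
  have S: "S *v x = g x" for x
    unfolding S_def using matrix_vector_mul(2)[OF lin] by (rule fun_cong)
  have sym: "transpose S = S"
    unfolding symmetric_matrix_iff S g_def
    by (auto simp: inner_sum_left inner_sum_right inner_commute intro!: sum.cong)
  have "x \<bullet> (S *v x) > 0" if "x \<noteq> 0" for x
  proof -
    obtain b where b: "b \<in> E" "x \<bullet> b \<noteq> 0"
      by (rule orthonormal_eigenbasis_nonzero_coordinate[OF eb UNIV_I \<open>x \<noteq> 0\<close>])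
    have "x \<bullet> (S *v x) = (\<Sum>b\<in>E. \<sigma> b * (x \<bullet> b)\<^sup>2)"
      unfolding S g_def by (simp add: inner_sum_right power2_eq_square ac_simps)
    also have "\<dots> > 0"
      using E(1) b pos by (intro sum_pos2[of _ b]) (auto simp: \<sigma>_def less_imp_le)
    finally show ?thesis .
  qed
  with sym have "pos_def S" by (simp add: pos_def_def)
  moreover have "S ** S = A"
  proof -
    have Sb: "S *v b = \<sigma> b *\<^sub>R b" if "b \<in> E" for b
    proof -
      have "S *v b = (\<Sum>c\<in>E. if c = b then \<sigma> b *\<^sub>R b else 0)"
        unfolding S g_def
        using E(3,5) that by (intro sum.cong) (auto simp: norm_eq_1)
      then show ?thesis using E(1) that by simp
    qed
    have Ab: "(S ** S) *v b = A *v b" if "b \<in> E" for b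
    proof -
      have "(S ** S) *v b = (\<sigma> b * \<sigma> b) *\<^sub>R b"
        using Sb[OF that] by (simp add: matrix_vector_mul_assoc[symmetric] matrix_vector_mult_scaleR)
      also have "\<dots> = A *v b"
        using pos[OF that] E(4)[OF that, symmetric] by (simp add: \<sigma>_def)
      finally show ?thesis .
    qed
    have "(S ** S) *v (\<Sum>b\<in>E. (x \<bullet> b) *\<^sub>R b) = A *v (\<Sum>b\<in>E. (x \<bullet> b) *\<^sub>R b)" for x
      by (simp add: linear_sum[OF matrix_vector_mul_linear] matrix_vector_mult_scaleR Ab)
    then show ?thesis by (simp add: E(6) matrix_eq)
  qed
  ultimately show ?thesis by blast
qed

text \<open>The difference \<open>D = S - T\<close> satisfies \<open>S D + D T = 0\<close>. Testing this on a unit eigenvector \<open>b\<close> of \<open>D\<close>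
  with eigenvalue \<open>\<mu>\<close> gives \<open>\<mu> (b \<bullet> S b + b \<bullet> T b) = 0\<close>, hence \<open>\<mu> = 0\<close>. So \<open>D\<close> vanishes on an
  eigenbasis.\<close>
lemma pos_def_sqrt_unique:
  fixes S T :: "real^'n^'n"
  assumes "pos_def S" "pos_def T" and eq: "S ** S = T ** T"
  shows "S = T"
proof -
  define D where "D = S - T"
  have Dx: "D *v x = S *v x - T *v x" for x
    by (simp add: D_def matrix_vector_mult_diff_rdistrib)
  have symS: "x \<bullet> (S *v y) = (S *v x) \<bullet> y" and symT: "x \<bullet> (T *v y) = (T *v x) \<bullet> y" for x y
    using assms symmetric_matrix_iff unfolding pos_def_def by blast+
  have "transpose D = D"
    unfolding symmetric_matrix_iff Dx by (simp add: inner_diff_left inner_diff_right symS symT)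
  then obtain E where eb: "orthonormal_eigenbasis ((*v) D) UNIV E"
    by (rule symmetric_matrix_eigenbasis)
  note E = orthonormal_eigenbasisD[OF this]
  have "D *v b = 0" if b: "b \<in> E" for b
  proof -
    define \<mu> where "\<mu> = b \<bullet> (D *v b)"
    have mu: "D *v b = \<mu> *\<^sub>R b" using E(4)[OF b] by (simp add: \<mu>_def)
    have "S *v (D *v b) + D *v (T *v b) = 0"
    proof -
      have "S *v (D *v b) = (S ** S) *v b - (S ** T) *v b"
        by (simp add: Dx matrix_vector_mult_diff_distrib matrix_vector_mul_assoc)
      moreover have "D *v (T *v b) = (S ** T) *v b - (T ** T) *v b"
        unfolding Dx by (simp add: matrix_vector_mul_assoc)
      ultimately show ?thesis by (simp add: eq)
    qed
    then have "b \<bullet> (S *v (D *v b)) + b \<bullet> (D *v (T *v b)) = 0"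
      by (metis inner_add_right inner_zero_right)
    moreover have "b \<bullet> (D *v (T *v b)) = (D *v b) \<bullet> (T *v b)"
      using \<open>transpose D = D\<close> symmetric_matrix_iff by blast
    ultimately have "\<mu> * (b \<bullet> (S *v b) + b \<bullet> (T *v b)) = 0"
      by (simp add: mu matrix_vector_mult_scaleR distrib_left)
    moreover have "b \<bullet> (S *v b) + b \<bullet> (T *v b) > 0"
      using E(3)[OF b] assms(1,2) unfolding pos_def_def
      by (metis add_pos_pos norm_zero zero_neq_one)
    ultimately show ?thesis by (simp add: mu)
  qed
  then have "D *v (\<Sum>b\<in>E. (x \<bullet> b) *\<^sub>R b) = 0" for x
    by (simp add: linear_sum[OF matrix_vector_mul_linear] matrix_vector_mult_scaleR)
  then have "D = 0" by (simp add: E(6) matrix_eq)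
  then show ?thesis by (simp add: D_def)
qed

lemma mat_sqrt:
  fixes A :: "real^'n^'n"
  assumes "pos_def A"
  shows "pos_def (mat_sqrt A)" "mat_sqrt A ** mat_sqrt A = A"
proof -
  have "\<exists>!S. pos_def S \<and> S ** S = A"
    using pos_def_sqrt_exists[OF assms] pos_def_sqrt_unique by blast
  from theI'[OF this] show "pos_def (mat_sqrt A)" "mat_sqrt A ** mat_sqrt A = A"
    unfolding mat_sqrt_def by blast+
qed

lemma matrix_inv_vector:
  fixes S :: "real^'n^'n"
  assumes "\<And>x. S *v x = 0 \<Longrightarrow> x = 0"
  shows "S *v (matrix_inv S *v x) = x" "matrix_inv S *v (S *v x) = x"
proof -
  have "invertible S"
    using assms matrix_left_invertible_ker[of S] by (simp add: invertible_left_inverse)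
  then have "S ** matrix_inv S = mat 1 \<and> matrix_inv S ** S = mat 1"
    unfolding invertible_def matrix_inv_def by (rule someI_ex)
  then show "S *v (matrix_inv S *v x) = x" "matrix_inv S *v (S *v x) = x"
    by (simp_all add: matrix_vector_mul_assoc)
qed

lemma pos_def_kernel:
  fixes S :: "real^'n^'n"
  assumes "pos_def S" "S *v x = 0"
  shows "x = 0"
  using assms unfolding pos_def_def by (metis inner_zero_right less_irrefl)

lemma mat_sqrt_inner:
  fixes A :: "real^'n^'n"
  assumes "pos_def A"
  shows "x \<bullet> (A *v y) = (mat_sqrt A *v x) \<bullet> (mat_sqrt A *v y)"
    and "x \<bullet> (mat_sqrt A *v y) = (mat_sqrt A *v x) \<bullet> y"
proof -
  have sym: "x \<bullet> (mat_sqrt A *v y) = (mat_sqrt A *v x) \<bullet> y" for x y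
    using mat_sqrt(1)[OF assms] symmetric_matrix_iff unfolding pos_def_def by blast
  show "x \<bullet> (mat_sqrt A *v y) = (mat_sqrt A *v x) \<bullet> y" by (rule sym)
  have "A *v y = mat_sqrt A *v (mat_sqrt A *v y)"
    using mat_sqrt(2)[OF assms] by (simp add: matrix_vector_mul_assoc)
  then show "x \<bullet> (A *v y) = (mat_sqrt A *v x) \<bullet> (mat_sqrt A *v y)"
    by (simp add: sym)
qed

lemma mat_sqrt_inv:
  fixes A :: "real^'n^'n"
  assumes "pos_def A"
  shows "mat_sqrt A *v (matrix_inv (mat_sqrt A) *v x) = x"
    "matrix_inv (mat_sqrt A) *v (mat_sqrt A *v x) = x"
  using matrix_inv_vector[of "mat_sqrt A" x] pos_def_kernel[OF mat_sqrt(1)[OF assms]] by blast+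

section \<open>Operator norms as extreme eigenvalues\<close>

lemma norm_matrix_le: "norm (A *v x) \<le> op_norm A * norm x" for A :: "real^'n^'m"
  by (rule onorm) (rule matrix_vector_mul_bounded_linear)

lemma op_norm_eqI:
  fixes A :: "real^'n^'m"
  assumes "\<And>x. norm (A *v x) \<le> c * norm x" and "norm (A *v v) = c * norm v" "v \<noteq> 0"
  shows "op_norm A = c"
proof (rule antisym)
  show "op_norm A \<le> c" by (rule onorm_le) (rule assms(1))
  have "c * norm v \<le> op_norm A * norm v"
    using norm_matrix_le[of A v] assms(2) by simp
  then show "c \<le> op_norm A" using assms(3) by simp
qed

lemma inner_transpose: "x \<bullet> (transpose C *v y) = (C *v x) \<bullet> y" for C :: "real^'n^'m"
  by (metis dot_lmul_matrix inner_commute transpose_matrix_vector)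

text \<open>Since \<open>(norm (R *v x))\<^sup>2\<close> is the quadratic form of \<open>transpose R ** R\<close>, its maximum on the unit sphere is
  the largest eigenvalue of that matrix. The unit vector attaining the norm is recorded because it
  turns the pointwise strict inequality \<open>norm (R *v w) < norm w\<close> into \<open>op_norm R < 1\<close>.\<close>
lemma op_norm_max_singular_value:
  fixes R :: "real^'n^'n"
  shows "op_norm R = max_singular_value R"
    and "\<exists>v. norm v = 1 \<and> norm (R *v v) = op_norm R"
proof -
  define G where "G = transpose R ** R"
  have G: "x \<bullet> (G *v y) = (R *v x) \<bullet> (R *v y)" for x y
    unfolding G_def matrix_vector_mul_assoc[symmetric] by (rule inner_transpose)
  have "transpose G = G"
    unfolding symmetric_matrix_iff by (metis G inner_commute)
  then obtain v where v: "norm v = 1" "G *v v = Max (eigenvalues G) *\<^sub>R v"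
    "\<And>x. x \<bullet> (G *v x) \<le> Max (eigenvalues G) * (norm x)\<^sup>2"
    using symmetric_Max_eigenvalue by blast
  define l where "l = Max (eigenvalues G)"
  have "v \<bullet> (G *v v) = l"
    unfolding v(2) l_def[symmetric] using v(1) by (simp add: norm_eq_1)
  then have Rv: "(norm (R *v v))\<^sup>2 = l" by (simp add: G power2_norm_eq_inner)
  have l: "l \<ge> 0" unfolding Rv[symmetric] by simp
  have "max_singular_value R = sqrt l"
  proof -
    have "eigenvalues G \<noteq> {}"
      using v(1,2) unfolding eigenvalues_def
      by (metis (mono_tags, lifting) empty_iff mem_Collect_eq norm_zero zero_neq_one)
    then have "sqrt (Max (eigenvalues G)) = Max (sqrt ` eigenvalues G)"
      using finite_eigenvalues_symmetric[OF \<open>transpose G = G\<close>]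
      by (intro mono_Max_commute) (simp_all add: mono_def)
    then show ?thesis by (simp add: max_singular_value_def singular_values_def G_def l_def)
  qed
  moreover have v_norm: "norm (R *v v) = sqrt l" using Rv by (simp add: real_sqrt_unique)
  moreover have "op_norm R = sqrt l"
  proof (rule op_norm_eqI)
    show "norm (R *v x) \<le> sqrt l * norm x" for x
    proof (rule power2_le_imp_le)
      show "(norm (R *v x))\<^sup>2 \<le> (sqrt l * norm x)\<^sup>2"
        using v(3)[of x] l by (simp add: G power2_norm_eq_inner[symmetric] power_mult_distrib l_def)
    qed (use l in simp)
    show "norm (R *v v) = sqrt l * norm v" using v_norm v(1) by simp
    show "v \<noteq> 0" using v(1) by auto
  qed
  ultimately show "op_norm R = max_singular_value R"
    "\<exists>v. norm v = 1 \<and> norm (R *v v) = op_norm R" using v(1) by auto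
qed

text \<open>The square root stretches every vector by at least the square root of the smallest eigenvalue of
  \<open>A\<close>, with equality at a corresponding eigenvector, so the inverse has the reciprocal norm.\<close>
lemma op_norm_inv_mat_sqrt:
  fixes A :: "real^'n^'n"
  assumes A: "pos_def A"
  shows "min_eigenvalue A > 0"
    and "op_norm (matrix_inv (mat_sqrt A)) = 1 / sqrt (min_eigenvalue A)"
proof -
  have "transpose A = A" using A by (simp add: pos_def_def)
  then obtain v where v: "norm v = 1" "A *v v = min_eigenvalue A *\<^sub>R v"
    "\<And>x. min_eigenvalue A * (norm x)\<^sup>2 \<le> x \<bullet> (A *v x)"
    using symmetric_min_eigenvalue by blast
  define l where "l = min_eigenvalue A"
  have v0: "v \<noteq> 0" using v(1) by auto
  have vAv: "v \<bullet> (A *v v) = l"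
    unfolding v(2) l_def[symmetric] using v(1) by (simp add: norm_eq_1)
  then have l: "l > 0" using A v0 by (auto simp: pos_def_def)
  then show "min_eigenvalue A > 0" by (simp add: l_def)
  have sqrtA: "(norm (mat_sqrt A *v x))\<^sup>2 = x \<bullet> (A *v x)" for x
    by (simp add: mat_sqrt_inner(1)[OF A] power2_norm_eq_inner)
  have low: "sqrt l * norm x \<le> norm (mat_sqrt A *v x)" for x
    by (rule power2_le_imp_le) (use l v(3)[of x] in \<open>simp_all add: sqrtA power_mult_distrib l_def\<close>)
  have "op_norm (matrix_inv (mat_sqrt A)) = 1 / sqrt l"
  proof (rule op_norm_eqI)
    show "norm (matrix_inv (mat_sqrt A) *v x) \<le> 1 / sqrt l * norm x" for x
      using low[of "matrix_inv (mat_sqrt A) *v x"] l by (simp add: mat_sqrt_inv[OF A] field_simps)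
    have "norm (mat_sqrt A *v v) = sqrt l"
      using sqrtA[of v] vAv by (metis norm_ge_zero real_sqrt_unique)
    then show "norm (matrix_inv (mat_sqrt A) *v (mat_sqrt A *v v)) = 1 / sqrt l * norm (mat_sqrt A *v v)"
      using l v(1) by (simp add: mat_sqrt_inv[OF A])
    then show "mat_sqrt A *v v \<noteq> 0" using \<open>norm (mat_sqrt A *v v) = sqrt l\<close> l by auto
  qed
  then show "op_norm (matrix_inv (mat_sqrt A)) = 1 / sqrt (min_eigenvalue A)"
    by (simp add: l_def)
qed

section \<open>Block matrices\<close>

definition join_vec :: "real^'n \<Rightarrow> real^'n \<Rightarrow> real^('n + 'n)" where
  "join_vec x y = (\<chi> i. case i of Inl k \<Rightarrow> x $ k | Inr k \<Rightarrow> y $ k)"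

lemma sum_UNIV_sum:
  "(\<Sum>i\<in>UNIV. h i) = (\<Sum>k\<in>UNIV. h (Inl k)) + (\<Sum>k\<in>UNIV. h (Inr k))"
  for h :: "'a::finite + 'b::finite \<Rightarrow> real"
  using sum.Plus[of "UNIV :: 'a set" "UNIV :: 'b set" h] by simp

lemma vec_sum_eq_iff:
  fixes z z' :: "real^('n::finite + 'n)"
  shows "z = z' \<longleftrightarrow> (\<forall>k. z $ Inl k = z' $ Inl k) \<and> (\<forall>k. z $ Inr k = z' $ Inr k)"
  unfolding vec_eq_iff by (metis sum.exhaust)

lemma join_vec_eq_0_iff: "join_vec x y = 0 \<longleftrightarrow> x = 0 \<and> y = 0"
  by (simp add: vec_sum_eq_iff join_vec_def vec_eq_iff)

lemma join_vec_eq_iff: "join_vec x y = join_vec x' y' \<longleftrightarrow> x = x' \<and> y = y'"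
  by (simp add: vec_sum_eq_iff join_vec_def vec_eq_iff)

lemma join_vec_split: "join_vec (\<chi> k. z $ Inl k) (\<chi> k. z $ Inr k) = z"
  by (simp add: vec_sum_eq_iff join_vec_def)

lemma inner_join_vec: "join_vec x y \<bullet> join_vec x' y' = x \<bullet> x' + y \<bullet> y'"
  by (simp add: inner_vec_def sum_UNIV_sum join_vec_def)

lemma block_mat_join_vec:
  "block_mat P Q S T *v join_vec x y = join_vec (P *v x + Q *v y) (S *v x + T *v y)"
  by (simp add: vec_sum_eq_iff matrix_vector_mult_def sum_UNIV_sum join_vec_def block_mat_def)

lemma upper_right_mult:
  "upper_right M *v y = (\<chi> k. (M *v join_vec 0 y) $ Inl k)"
  by (simp add: vec_eq_iff matrix_vector_mult_def sum_UNIV_sum join_vec_def upper_right_def)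

lemma pos_def_diagonal_blocks:
  fixes A B :: "real^'n^'n"
  assumes "pos_def (block_mat A C D B)"
  shows "pos_def A" "pos_def B"
proof -
  let ?M = "block_mat A C D B"
  have sym: "z \<bullet> (?M *v z') = (?M *v z) \<bullet> z'" for z z'
    using assms symmetric_matrix_iff unfolding pos_def_def by blast
  have pos: "z \<bullet> (?M *v z) > 0" if "z \<noteq> 0" for z
    using assms that by (simp add: pos_def_def)
  have A: "x \<bullet> (A *v y) = join_vec x 0 \<bullet> (?M *v join_vec y 0)"
   and B: "x \<bullet> (B *v y) = join_vec 0 x \<bullet> (?M *v join_vec 0 y)" for x y
    by (simp_all add: block_mat_join_vec inner_join_vec)
  show "pos_def A"
    unfolding pos_def_def symmetric_matrix_iff
    by (metis A sym pos inner_commute join_vec_eq_0_iff)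
  show "pos_def B"
    unfolding pos_def_def symmetric_matrix_iff
    by (metis B sym pos inner_commute join_vec_eq_0_iff)
qed

section \<open>The off-diagonal block of the inverse\<close>

text \<open>The diagonal blocks turn into identities in the coordinates given by the square roots of \<open>A\<close> and \<open>B\<close>,
  and the off-diagonal block turns into \<open>R\<close>. For fixed nonzero \<open>w\<close>, the form
  \<open>u \<bullet> u + 2 (u \<bullet> R w) + w \<bullet> w\<close> is smallest at \<open>u = - R w\<close>, where positivity says
  \<open>norm (R *v w) < norm w\<close>.\<close>
lemma correlation_op_norm_less_1:
  fixes A B C R :: "real^'n^'n"
  assumes pd: "pos_def (block_mat A C (transpose C) B)"
    and C: "C = mat_sqrt A ** R ** mat_sqrt B"
  shows "op_norm R < 1"
proof -
  note A = pos_def_diagonal_blocks(1)[OF pd] and B = pos_def_diagonal_blocks(2)[OF pd]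
  obtain w where w: "norm w = 1" "norm (R *v w) = op_norm R"
    using op_norm_max_singular_value(2) by blast
  define p where "p = matrix_inv (mat_sqrt A) *v (- (R *v w))"
  define q where "q = matrix_inv (mat_sqrt B) *v w"
  have Sp: "mat_sqrt A *v p = - (R *v w)" and Sq: "mat_sqrt B *v q = w"
    by (simp_all add: p_def q_def mat_sqrt_inv A B)
  have "q \<noteq> 0" using Sq w(1) by auto
  then have "0 < join_vec p q \<bullet> (block_mat A C (transpose C) B *v join_vec p q)"
    using pd by (simp add: pos_def_def join_vec_eq_0_iff)
  also have "\<dots> = p \<bullet> (A *v p) + 2 * (p \<bullet> (C *v q)) + q \<bullet> (B *v q)"
    unfolding block_mat_join_vec inner_join_vec inner_add_right inner_transpose
    by (simp add: inner_commute)
  also have "p \<bullet> (C *v q) = - ((R *v w) \<bullet> (R *v w))"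
    unfolding C matrix_vector_mul_assoc[symmetric] mat_sqrt_inner(2)[OF A] Sp Sq by simp
  finally have "(norm (R *v w))\<^sup>2 < 1"
    using w(1) by (simp add: mat_sqrt_inner(1) A B Sp Sq power2_norm_eq_inner norm_eq_1)
  then show ?thesis
    using w(2) by (metis abs_norm_cancel abs_square_less_1)
qed

text \<open>By block elimination \<open>\<Gamma>\<^sub>1\<^sub>2 = - A\<^sup>-\<^sup>1\<^sup>/\<^sup>2 R (I - R\<^sup>T R)\<^sup>-\<^sup>1 B\<^sup>-\<^sup>1\<^sup>/\<^sup>2\<close>, which explains the four factors of the
  bound. The proof estimates the solution of the block system directly: this replaces the inverse of
  \<open>I - R\<^sup>T R\<close> by the energy identity \<open>\<parallel>w\<parallel>\<^sup>2 - \<parallel>u\<parallel>\<^sup>2 = q \<bullet> y\<close>.\<close>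
lemma upper_right_inverse_bound:
  fixes A B C R :: "real^'n^'n"
  assumes pd: "pos_def (block_mat A C (transpose C) B)"
    and C: "C = mat_sqrt A ** R ** mat_sqrt B"
  defines "\<alpha> \<equiv> op_norm (matrix_inv (mat_sqrt A))"
    and "\<beta> \<equiv> op_norm (matrix_inv (mat_sqrt B))" and "r \<equiv> op_norm R"
  shows "norm (upper_right (matrix_inv (block_mat A C (transpose C) B)) *v y)
    \<le> \<alpha> * \<beta> * (r / (1 - r\<^sup>2)) * norm y"
proof -
  note A = pos_def_diagonal_blocks(1)[OF pd] and B = pos_def_diagonal_blocks(2)[OF pd]
  let ?M = "block_mat A C (transpose C) B"
  have nonneg: "\<alpha> \<ge> 0" "\<beta> \<ge> 0" "r \<ge> 0"
    unfolding \<alpha>_def \<beta>_def r_def by (simp_all add: onorm_pos_le)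
  have "r < 1" unfolding r_def by (rule correlation_op_norm_less_1[OF pd C])
  then have r2: "r\<^sup>2 < 1" using nonneg by (simp add: abs_square_less_1)
  define z where "z = matrix_inv ?M *v join_vec 0 y"
  define p where "p = (\<chi> k. z $ Inl k)"
  define q where "q = (\<chi> k. z $ Inr k)"
  have z: "z = join_vec p q" unfolding p_def q_def by (rule join_vec_split[symmetric])
  have "?M *v z = join_vec 0 y"
    unfolding z_def using pos_def_kernel[OF pd] by (intro matrix_inv_vector)
  then have eqs: "A *v p + C *v q = 0" "transpose C *v p + B *v q = y"
    unfolding z block_mat_join_vec join_vec_eq_iff by blast+
  define u where "u = mat_sqrt A *v p"
  define w where "w = mat_sqrt B *v q"
  have "mat_sqrt A *v (u + R *v w) = A *v p + C *v q"
    by (simp add: u_def w_def C matrix_vector_right_distrib matrix_vector_mul_assoc matrix_mul_assoc mat_sqrt(2)[OF A])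
  with eqs(1) have "u + R *v w = 0"
    using pos_def_kernel[OF mat_sqrt(1)[OF A]] by metis
  then have "norm u = norm (R *v w)" by (metis add_eq_0_iff2 norm_minus_cancel)
  then have u_le: "norm u \<le> r * norm w" unfolding r_def using norm_matrix_le[of R w] by simp
  \<comment> \<open>The cross terms of the two rows agree up to sign, so pairing the second row with \<open>q\<close> produces
    the energy of \<open>w\<close> minus that of \<open>u\<close>.\<close>
  have "(norm w)\<^sup>2 - (norm u)\<^sup>2 = q \<bullet> y"
  proof -
    have "(C *v q) \<bullet> p = - (p \<bullet> (A *v p))"
      using eqs(1) by (metis add_eq_0_iff inner_commute inner_minus_right)
    then have "q \<bullet> (transpose C *v p) = - (norm u)\<^sup>2"
      unfolding inner_transpose by (simp add: mat_sqrt_inner(1)[OF A] u_def power2_norm_eq_inner)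
    moreover have "q \<bullet> (B *v q) = (norm w)\<^sup>2"
      by (simp add: mat_sqrt_inner(1)[OF B] w_def power2_norm_eq_inner)
    ultimately show ?thesis unfolding eqs(2)[symmetric] inner_add_right by simp
  qed
  also have "\<dots> \<le> norm q * norm y" by (rule norm_cauchy_schwarz)
  also have "norm q \<le> \<beta> * norm w"
    using norm_matrix_le[of "matrix_inv (mat_sqrt B)" w] by (simp add: w_def mat_sqrt_inv[OF B] \<beta>_def)
  finally have "(norm w)\<^sup>2 - (norm u)\<^sup>2 \<le> \<beta> * norm w * norm y"
    by (simp add: mult_right_mono)
  moreover have "(norm u)\<^sup>2 \<le> (r * norm w)\<^sup>2" using u_le by (intro power_mono) simp_all
  ultimately have "norm w * ((1 - r\<^sup>2) * norm w) \<le> norm w * (\<beta> * norm y)"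
    by (simp add: power_mult_distrib algebra_simps power2_eq_square)
  then have "(1 - r\<^sup>2) * norm w \<le> \<beta> * norm y"
    using nonneg by (cases "w = 0") simp_all
  then have w_le: "norm w \<le> \<beta> * norm y / (1 - r\<^sup>2)" using r2 by (simp add: field_simps)
  have "norm p \<le> \<alpha> * norm u"
    using norm_matrix_le[of "matrix_inv (mat_sqrt A)" u] by (simp add: u_def mat_sqrt_inv[OF A] \<alpha>_def)
  also have "\<dots> \<le> \<alpha> * (r * (\<beta> * norm y / (1 - r\<^sup>2)))"
    using u_le w_le nonneg by (meson mult_left_mono order_trans)
  finally show ?thesis
    by (simp add: upper_right_mult z_def p_def ac_simps)
qed

theorem lemma4p2:
  fixes \<Sigma> :: "real^('n::finite + 'n)^('n + 'n)"
    and A B C R :: "real^'n::finite^'n"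
    and \<epsilon> :: real
  assumes "pos_def \<Sigma>" and "\<epsilon> > 0"
    and "\<Sigma> = block_mat A C (transpose C) B"
    and "C = mat_sqrt A ** R ** mat_sqrt B"
  shows "(\<epsilon> * (op_norm R / (1 - (op_norm R)\<^sup>2))
            < 1 / (op_norm (matrix_inv (mat_sqrt A)) * op_norm (matrix_inv (mat_sqrt B)))
          \<longrightarrow> invertible (mat 1 - \<epsilon> *\<^sub>R upper_right (matrix_inv \<Sigma>)))
       \<and> (\<epsilon> * (max_singular_value R / (1 - (max_singular_value R)\<^sup>2))
            < sqrt (min_eigenvalue A * min_eigenvalue B)
          \<longrightarrow> invertible (mat 1 - \<epsilon> *\<^sub>R upper_right (matrix_inv \<Sigma>)))
       \<and> (\<epsilon> * (op_norm R / (1 - (op_norm R)\<^sup>2))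
            < 1 / (op_norm (matrix_inv (mat_sqrt A)) * op_norm (matrix_inv (mat_sqrt B)))
          \<longleftrightarrow> \<epsilon> * (max_singular_value R / (1 - (max_singular_value R)\<^sup>2))
            < sqrt (min_eigenvalue A * min_eigenvalue B))"
proof -
  define \<alpha> where "\<alpha> = op_norm (matrix_inv (mat_sqrt A))"
  define \<beta> where "\<beta> = op_norm (matrix_inv (mat_sqrt B))"
  define \<kappa> where "\<kappa> = op_norm R / (1 - (op_norm R)\<^sup>2)"
  define \<Gamma> where "\<Gamma> = upper_right (matrix_inv \<Sigma>)"
  have pd: "pos_def (block_mat A C (transpose C) B)" using assms(1,3) by simp
  note A = pos_def_diagonal_blocks(1)[OF pd] and B = pos_def_diagonal_blocks(2)[OF pd]
  have rhs: "1 / (\<alpha> * \<beta>) = sqrt (min_eigenvalue A * min_eigenvalue B)"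
    unfolding \<alpha>_def \<beta>_def op_norm_inv_mat_sqrt(2)[OF A] op_norm_inv_mat_sqrt(2)[OF B]
    by (simp add: real_sqrt_mult)
  have lhs: "\<kappa> = max_singular_value R / (1 - (max_singular_value R)\<^sup>2)"
    by (simp add: \<kappa>_def op_norm_max_singular_value(1))
  have pos: "\<alpha> * \<beta> > 0"
    unfolding \<alpha>_def \<beta>_def op_norm_inv_mat_sqrt(2)[OF A] op_norm_inv_mat_sqrt(2)[OF B]
    using op_norm_inv_mat_sqrt(1)[OF A] op_norm_inv_mat_sqrt(1)[OF B] by simp
  have "invertible (mat 1 - \<epsilon> *\<^sub>R \<Gamma>)" if small: "\<epsilon> * \<kappa> < 1 / (\<alpha> * \<beta>)"
  proof -
    have "y = 0" if "(mat 1 - \<epsilon> *\<^sub>R \<Gamma>) *v y = 0" for y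
    proof (rule ccontr)
      assume "y \<noteq> 0"
      have "y = \<epsilon> *\<^sub>R (\<Gamma> *v y)"
        using that by (simp add: matrix_vector_mult_diff_rdistrib scaleR_matrix_vector_assoc)
      then have "norm y = \<epsilon> * norm (\<Gamma> *v y)"
        using assms(2) by (metis abs_of_pos norm_scaleR)
      also have "\<dots> \<le> \<epsilon> * (\<alpha> * \<beta> * \<kappa> * norm y)"
        using upper_right_inverse_bound[OF pd assms(4), of y] assms(2)
        unfolding \<Gamma>_def \<alpha>_def \<beta>_def \<kappa>_def assms(3) by (intro mult_left_mono) simp_all
      also have "\<dots> = (\<epsilon> * \<kappa> * (\<alpha> * \<beta>)) * norm y" by simp
      also have "\<dots> < 1 * norm y"
        using small pos \<open>y \<noteq> 0\<close> by (intro mult_strict_right_mono) (simp_all add: pos_less_divide_eq)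
      finally show False by simp
    qed
    then show ?thesis
      using matrix_left_invertible_ker[of "mat 1 - \<epsilon> *\<^sub>R \<Gamma>"] by (simp add: invertible_left_inverse)
  qed
  then show ?thesis
    unfolding rhs[unfolded \<alpha>_def \<beta>_def] lhs[unfolded \<kappa>_def] \<Gamma>_def lhs rhs by blast
qed

end
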